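(* For all formulas $\phi,\psi,\chi$ of the team language, the formula $(\phi\to\chi)\to(\phi\vee\psi\to\chi\vee\psi)$ is valid on every distributive general intuitionistic team Kripke frame.
   Context: **Language.** Fix a set $\mathsf{Prop}$ of propositional variables. Formulas of the team language are $\phi::=p\mid\bot\mid\phi\wedge\phi\mid\phi\vee\phi\mid\phi\veebar\phi\mid\phi\to\phi$; $\vee$ is the local and $\veebar$ the global disjunction; $\vee$ and $\veebar$ bind more strongly than $\to$. **Frames.** For a nonempty set $W$ with a partial order $R$, teams are sets $t\subseteq W$; $R[t]=\{v\mid\exists w\in t:\ wRv\}$; and $tR^\circ s$ iff $\forall w\in t\,\exists v\in s\,(wRv)$ and $\forall v\in s\,\exists w\in t\,(wRv)$. A general intuitionistic team Kripke frame is $(W,R,\succcurlyeq,\Cup)$ where $W\neq\varnothing$, $R$ is a partial order on $W$, $\Cup$ is a binary operation on $\wp(W)$ such that $(\wp(W),\Cup,\varnothing)$ is a bounded join-semilattice ($\Cup$ associative, commutative, idempotent, $\varnothing\Cup t=t$), $\preccurlyeq$ is the induced partial order ($t\preccurlyeq s$ iff $t\Cup s=s$) with converse $\succcurlyeq$, and for all $t,s,s'\subseteq W$: - (a) if $tR^\circ s$ and $s\succcurlyeq s'$, then there is $t'\subseteq W$ with $t\succcurlyeq t'$ and $t'R^\circ s'$; - (b) $t\succcurlyeq\circ R^\circ s$ implies $R[t]\succcurlyeq s$, where $t\succcurlyeq\circ R^\circ s$ means there is $r\subseteq W$ with $t\succcurlyeq r$ and $rR^\circ s$; - (c) $R[t]\Cup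 R[s]=R[t\Cup s]$. The frame is distributive if for all $t,r,s\subseteq W$, $t\preccurlyeq r\Cup s$ implies that there are $r',s'\subseteq W$ with $r'\preccurlyeq r$, $s'\preccurlyeq s$ and $t=r'\Cup s'$. A model on the frame adds a valuation $V:\mathsf{Prop}\to\wp(W)$ persistent w.r.t. $R$ ($w\in V(p)$, $wRv$ imply $v\in V(p)$). **Generalized team semantics:** - $\mathfrak{M},t\models p$ iff $t\preccurlyeq V(p)$; - $\mathfrak{M},t\models\bot$ iff $t=\varnothing$; - $\mathfrak{M},t\models\phi\wedge\psi$ iff $\mathfrak{M},t\models\phi$ and $\mathfrak{M},t\models\psi$; - $\mathfrak{M},t\models\phi\vee\psi$ iff there are $s,r\subseteq W$ with $t\preccurlyeq s\Cup r$, $\mathfrak{M},s\models\phi$ and $\mathfrak{M},r\models\psi$; - $\mathfrak{M},t\models\phi\veebar\psi$ iff $\mathfrak{M},t\models\phi$ or $\mathfrak{M},t\models\psi$; - $\mathfrak{M},t\models\phi\to\psi$ iff for all $s\subseteq W$ with $t\succcurlyeq\circ R^\circ s$, $\mathfrak{M},s\models\phi$ implies $\mathfrak{M},s\models\psi$. A formula is valid on a frame if it holds at all teams in all models on the frame. *)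

theory Defs
  imports Main
begin

datatype 'p form =
    Var 'p
  | Bot
  | And "'p form" "'p form"
  | LOr "'p form" "'p form"   \<comment> \<open>local disjunction\<close>
  | GOr "'p form" "'p form"   \<comment> \<open>global disjunction\<close>
  | Imp "'p form" "'p form"

definition team_lift :: "'w rel \<Rightarrow> 'w set \<Rightarrow> 'w set \<Rightarrow> bool" where
  "team_lift R t s \<longleftrightarrow>
     (\<forall>w\<in>t. \<exists>v\<in>s. (w, v) \<in> R) \<and> (\<forall>v\<in>s. \<exists>w\<in>t. (w, v) \<in> R)"

definition join_le :: "('w set \<Rightarrow> 'w set \<Rightarrow> 'w set) \<Rightarrow> 'w set \<Rightarrow> 'w set \<Rightarrow> bool" where
  "join_le J t s \<longleftrightarrow> J t s = s"

text \<open>The composition of the converse of \<^term>\<open>join_le J\<close> with \<^term>\<open>team_lift R\<close>,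
  through teams contained in \<^term>\<open>W\<close>.\<close>

definition team_step ::
  "'w set \<Rightarrow> 'w rel \<Rightarrow> ('w set \<Rightarrow> 'w set \<Rightarrow> 'w set) \<Rightarrow> 'w set \<Rightarrow> 'w set \<Rightarrow> bool" where
  "team_step W R J t s \<longleftrightarrow> (\<exists>r\<subseteq>W. join_le J r t \<and> team_lift R r s)"

text \<open>The order on teams is not a separate component: it is always the one induced by the
  join operation. The operation is constrained only on subsets of the carrier.\<close>

locale general_team_frame =
  fixes W :: "'w set"
    and R :: "'w rel"
    and J :: "'w set \<Rightarrow> 'w set \<Rightarrow> 'w set"
  assumes nonempty: "W \<noteq> {}"
    and order: "partial_order_on W R"
    and join_closed: "\<lbrakk>t \<subseteq> W; s \<subseteq> W\<rbrakk> \<Longrightarrow> J t s \<subseteq> W"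
    and join_assoc: "\<lbrakk>t \<subseteq> W; s \<subseteq> W; r \<subseteq> W\<rbrakk> \<Longrightarrow> J (J t s) r = J t (J s r)"
    and join_comm: "\<lbrakk>t \<subseteq> W; s \<subseteq> W\<rbrakk> \<Longrightarrow> J t s = J s t"
    and join_idem: "t \<subseteq> W \<Longrightarrow> J t t = t"
    and join_empty: "t \<subseteq> W \<Longrightarrow> J {} t = t"
    and lift_restrict: "\<lbrakk>t \<subseteq> W; s \<subseteq> W; s' \<subseteq> W; team_lift R t s; join_le J s' s\<rbrakk>
          \<Longrightarrow> \<exists>t'\<subseteq>W. join_le J t' t \<and> team_lift R t' s'"
    and step_le_image: "\<lbrakk>t \<subseteq> W; s \<subseteq> W; team_step W R J t s\<rbrakk> \<Longrightarrow> join_le J s (R `` t)"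
    and image_join: "\<lbrakk>t \<subseteq> W; s \<subseteq> W\<rbrakk> \<Longrightarrow> J (R `` t) (R `` s) = R `` (J t s)"

locale distributive_team_frame = general_team_frame W R J
  for W :: "'w set" and R :: "'w rel" and J :: "'w set \<Rightarrow> 'w set \<Rightarrow> 'w set" +
  assumes distributive: "\<lbrakk>t \<subseteq> W; r \<subseteq> W; s \<subseteq> W; join_le J t (J r s)\<rbrakk>
          \<Longrightarrow> \<exists>r'\<subseteq>W. \<exists>s'\<subseteq>W. join_le J r' r \<and> join_le J s' s \<and> t = J r' s'"

definition valuation :: "'w set \<Rightarrow> 'w rel \<Rightarrow> ('p \<Rightarrow> 'w set) \<Rightarrow> bool" where
  "valuation W R V \<longleftrightarrow>
     (\<forall>p. V p \<subseteq> W) \<and> (\<forall>p w v. w \<in> V p \<longrightarrow> (w, v) \<in> R \<longrightarrow> v \<in> V p)"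

primrec sat :: "'w set \<Rightarrow> 'w rel \<Rightarrow> ('w set \<Rightarrow> 'w set \<Rightarrow> 'w set) \<Rightarrow> ('p \<Rightarrow> 'w set) \<Rightarrow>
    'w set \<Rightarrow> 'p form \<Rightarrow> bool" where
  "sat W R J V t (Var p) \<longleftrightarrow> join_le J t (V p)"
| "sat W R J V t Bot \<longleftrightarrow> t = {}"
| "sat W R J V t (And \<phi> \<psi>) \<longleftrightarrow> sat W R J V t \<phi> \<and> sat W R J V t \<psi>"
| "sat W R J V t (LOr \<phi> \<psi>) \<longleftrightarrow>
     (\<exists>s\<subseteq>W. \<exists>r\<subseteq>W. join_le J t (J s r) \<and> sat W R J V s \<phi> \<and> sat W R J V r \<psi>)"
| "sat W R J V t (GOr \<phi> \<psi>) \<longleftrightarrow> sat W R J V t \<phi> \<or> sat W R J V t \<psi>"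
| "sat W R J V t (Imp \<phi> \<psi>) \<longleftrightarrow>
     (\<forall>s\<subseteq>W. team_step W R J t s \<longrightarrow> sat W R J V s \<phi> \<longrightarrow> sat W R J V s \<psi>)"

definition valid_on_frame ::
  "'w set \<Rightarrow> 'w rel \<Rightarrow> ('w set \<Rightarrow> 'w set \<Rightarrow> 'w set) \<Rightarrow> 'p form \<Rightarrow> bool" where
  "valid_on_frame W R J \<phi> \<longleftrightarrow> (\<forall>V. valuation W R V \<longrightarrow> (\<forall>t\<subseteq>W. sat W R J V t \<phi>))"

end

theory Submission
  imports Defs
begin

text \<open>Let \<open>v\<close> be reached from a team \<open>u\<close> satisfying \<open>\<phi> \<rightarrow> \<chi>\<close>, and let \<open>v\<close> lie below a join of
  a team satisfying \<open>\<phi>\<close> and one satisfying \<open>\<psi>\<close>. By distributivity \<open>v\<close> is itself the join of teams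
  \<open>s'\<close>, \<open>r'\<close> below these, and satisfaction is inherited downwards, so \<open>s'\<close> satisfies \<open>\<phi>\<close> and \<open>r'\<close>
  satisfies \<open>\<psi>\<close>. Frame condition (a) shows that \<open>s'\<close> is still reached from \<open>u\<close>, so it satisfies \<open>\<chi>\<close>.\<close>

context general_team_frame
begin

lemma join_le_refl: "t \<subseteq> W \<Longrightarrow> join_le J t t"
  by (simp add: join_le_def join_idem)

lemma join_le_trans:
  assumes "t \<subseteq> W" "s \<subseteq> W" "r \<subseteq> W" "join_le J t s" "join_le J s r"
  shows "join_le J t r"
  using join_assoc[of t s r] assms by (simp add: join_le_def)

lemma join_le_empty: "t \<subseteq> W \<Longrightarrow> join_le J t {} \<Longrightarrow> t = {}"
  using join_comm[of t "{}"] join_empty[of t] by (simp add: join_le_def)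

lemma team_step_mono:
  assumes "s \<subseteq> W" "t \<subseteq> W" "join_le J s t" "team_step W R J s u"
  shows "team_step W R J t u"
  using assms join_le_trans[of _ s t] unfolding team_step_def by blast

text \<open>Condition (a) pulls \<open>s\<close> back along the lift to a team below the
  intermediate one, hence below \<open>u\<close>.\<close>

lemma team_step_restrict:
  assumes "u \<subseteq> W" "v \<subseteq> W" "s \<subseteq> W" "team_step W R J u v" "join_le J s v"
  shows "team_step W R J u s"
proof -
  obtain q where q: "q \<subseteq> W" "join_le J q u" "team_lift R q v"
    using assms(4) unfolding team_step_def by blast
  obtain q' where "q' \<subseteq> W" "join_le J q' q" "team_lift R q' s"
    using lift_restrict[OF q(1) assms(2,3) q(3) assms(5)] by blast
  then show ?thesis
    using join_le_trans[of q' q u] q assms(1) unfolding team_step_def by blast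
qed

text \<open>For an implication, a smaller team reaches no teams beyond those a larger one reaches;
  for variables and local disjunctions the order is transitive.\<close>

lemma sat_downward:
  assumes V: "valuation W R V"
    and "s \<subseteq> W" "t \<subseteq> W" "join_le J s t" "sat W R J V t \<phi>"
  shows "sat W R J V s \<phi>"
  using assms(2-)
proof (induction \<phi> arbitrary: s t)
  case (Var p)
  then show ?case
    using V join_le_trans[of s t "V p"] by (simp add: valuation_def)
next
  case Bot
  then show ?case
    using join_le_empty[of s] by simp
next
  case (And \<phi> \<psi>)
  then show ?case
    by (metis sat.simps(3))
next
  case (LOr \<phi> \<psi>)
  then obtain a b where ab: "a \<subseteq> W" "b \<subseteq> W" "join_le J t (J a b)"
      "sat W R J V a \<phi>" "sat W R J V b \<psi>"
    by auto
  then have "join_le J s (J a b)"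
    using LOr.prems join_le_trans[of s t "J a b"] join_closed by simp
  then show ?case
    using ab by auto
next
  case (GOr \<phi> \<psi>)
  then show ?case
    by (metis sat.simps(5))
next
  case (Imp \<phi> \<psi>)
  then show ?case
    using team_step_mono[of s t] by simp
qed

end

theorem proposition4p26:
  fixes W :: "'w set"
    and R :: "'w rel"
    and J :: "'w set \<Rightarrow> 'w set \<Rightarrow> 'w set"
    and \<phi> \<psi> \<chi> :: "'p form"
  assumes "distributive_team_frame W R J"
  shows "valid_on_frame W R J (Imp (Imp \<phi> \<chi>) (Imp (LOr \<phi> \<psi>) (LOr \<chi> \<psi>)))"
proof -
  interpret distributive_team_frame W R J by fact
  have "sat W R J V v (LOr \<chi> \<psi>)"
    if V: "valuation W R V" and u: "u \<subseteq> W" "sat W R J V u (Imp \<phi> \<chi>)"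
      and v: "v \<subseteq> W" "team_step W R J u v" "sat W R J V v (LOr \<phi> \<psi>)"
    for V u v
  proof -
    obtain s r where sr: "s \<subseteq> W" "r \<subseteq> W" "join_le J v (J s r)"
        "sat W R J V s \<phi>" "sat W R J V r \<psi>"
      using v(3) by auto
    obtain s' r' where sr': "s' \<subseteq> W" "r' \<subseteq> W" "join_le J s' s" "join_le J r' r" "v = J s' r'"
      using distributive[OF v(1) sr(1-3)] by blast
    have "sat W R J V s' \<phi>" and \<psi>: "sat W R J V r' \<psi>"
      using sat_downward[OF V sr'(1) sr(1)] sat_downward[OF V sr'(2) sr(2)] sr sr' by simp_all
    \<comment> \<open>Idempotence absorbs the repeated \<open>s'\<close> in
      \<open>J s' (J s' r')\<close>.\<close>
    moreover have "join_le J s' v"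
      using join_assoc[of s' s' r'] sr' by (simp add: join_le_def join_idem)
    ultimately have "sat W R J V s' \<chi>"
      using team_step_restrict[OF u(1) v(1) sr'(1) v(2)] u(2) sr'(1) by simp
    then show ?thesis
      using \<psi> sr'(1,2,5) join_le_refl[OF v(1)] by auto
  qed
  \<comment> \<open>Only the implications unfold; the disjunctions stay folded to match the fact
    above.\<close>
  then show ?thesis
    by (simp add: valid_on_frame_def del: sat.simps(4))
qed

end
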